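(* Let $n\ge2$, $\alpha\in\mathbb{Z}_{\ge1}^n$ and $d:=\sum_{j=1}^n\alpha_j$. Then $$\max_{x\in[0,1]^n}\Big(x^\alpha-\max\Big\{0,\ 1+\sum_{j=1}^n\alpha_j(x_j-1)\Big\}\Big)=\Big(1-\frac1d\Big)^d.$$ In particular, for the multilinear monomial $m(x)=\prod_{j=1}^n x_j$, $$\mu\big(\mathcal{G}(\operatorname{vex}_{[0,1]^n}[m])\big)=\Big(1-\frac1n\Big)^n.$$
   Context: $x^\alpha=\prod_jx_j^{\alpha_j}$. $\operatorname{vex}_{[0,1]^n}[m]$ is the convex envelope of $m$ over $[0,1]^n$ (the pointwise supremum of all convex underestimators of $m$ on $[0,1]^n$), and $\mu(\mathcal{G}(\operatorname{vex}_{[0,1]^n}[m]))$ is its error, i.e. $\max_{x\in[0,1]^n}\big|\operatorname{vex}_{[0,1]^n}[m](x)-m(x)\big|$. *)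

theory Defs
  imports "HOL-Analysis.Analysis"
begin

definition has_max_on :: "('a \<Rightarrow> real) \<Rightarrow> 'a set \<Rightarrow> real \<Rightarrow> bool" where
  "has_max_on f S v \<longleftrightarrow> (\<exists>x\<in>S. f x = v) \<and> (\<forall>x\<in>S. f x \<le> v)"

text \<open>The supremum below is taken in the conditionally complete type of reals, so it is meaningful
  for \<open>x \<in> S\<close> (where it is bounded above by \<open>f x\<close>) provided that \<open>f\<close> has some convex underestimator
  on \<open>S\<close>; for convex \<open>S\<close> it suffices that \<open>f\<close> is bounded below on \<open>S\<close>.\<close>

definition convex_envelope :: "'a::real_vector set \<Rightarrow> ('a \<Rightarrow> real) \<Rightarrow> 'a \<Rightarrow> real" where
  "convex_envelope S f x = Sup {g x | g. convex_on S g \<and> (\<forall>y\<in>S. g y \<le> f y)}"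

end

theory Submission
  imports Defs
begin

text \<open>By AM-GM the gap at \<open>x\<close> is at most \<open>s\<^sup>d - max 0 (1 - d (1 - s))\<close>, where \<open>s\<close> is the
  \<open>\<alpha>\<close>-weighted mean of the coordinates of \<open>x\<close>, with equality on the diagonal. This increases in
  \<open>s\<close> up to \<open>1 - 1/d\<close> and decreases afterwards. For the multilinear monomial, the function
  \<open>max 0 (1 + \<Sum>\<^sub>j (x\<^sub>j - 1))\<close> is a convex underestimator, so the gap bounds the envelope error; at
  the maximiser \<open>(1 - 1/n, \<dots>, 1 - 1/n)\<close> every convex underestimator is nonpositive, so the
  bound is attained.\<close>

text \<open>The difference of powers factors as \<open>s - c\<close> times a sum of \<open>d\<close>
  products, each at most 1 on the unit interval. This controls the gap once the affine term is
  positive.\<close>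

lemma power_diff_le_of_unit_interval:
  fixes c s :: real
  assumes "0 \<le> c" "c \<le> s" "s \<le> 1"
  shows "s ^ d - c ^ d \<le> real d * (s - c)"
proof -
  have "c ^ (d - Suc i) * s ^ i \<le> 1" for i
    using assms by (intro mult_le_one power_le_one zero_le_power) auto
  then have "(\<Sum>i<d. c ^ (d - Suc i) * s ^ i) \<le> (\<Sum>i<d. 1)"
    by (intro sum_mono)
  then have "(s - c) * (\<Sum>i<d. c ^ (d - Suc i) * s ^ i) \<le> (s - c) * real d"
    using assms by (intro mult_left_mono) auto
  then show ?thesis
    by (simp add: power_diff_sumr2 mult.commute)
qed

lemma weighted_arith_geom_mean:
  fixes x :: "'a \<Rightarrow> real" and w :: "'a \<Rightarrow> nat"
  assumes "finite S" and "\<And>i. i \<in> S \<Longrightarrow> 0 \<le> x i" and "0 < sum w S"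
  shows "(\<Prod>i\<in>S. x i ^ w i) \<le> ((\<Sum>i\<in>S. real (w i) * x i) / real (sum w S)) ^ sum w S"
proof -
  \<comment> \<open>\<open>T\<close> holds \<open>w i\<close> copies of each index \<open>i\<close>,
    so the unweighted AM-GM inequality over \<open>T\<close> is the weighted one over
    \<open>S\<close>.\<close>
  define T where "T = Sigma S (\<lambda>i. {..<w i})"
  define d where "d = sum w S"
  have T: "finite T" "card T = d"
    using assms(1) by (simp_all add: T_def d_def)
  have "T \<noteq> {}"
    using T assms(3) d_def by auto
  have prod: "(\<Prod>p\<in>T. x (fst p)) = (\<Prod>i\<in>S. x i ^ w i)"
    using prod.Sigma[of S "\<lambda>i. {..<w i}" "\<lambda>i _. x i"] assms(1)
    by (simp add: T_def split_def)
  have sum: "(\<Sum>p\<in>T. x (fst p) / card T) = (\<Sum>i\<in>S. real (w i) * x i) / d"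
    using sum.Sigma[of S "\<lambda>i. {..<w i}" "\<lambda>i _. x i / d"] assms(1) T(2)
    by (simp add: T_def split_def sum_divide_distrib)
  have nonneg: "0 \<le> (\<Prod>i\<in>S. x i ^ w i)"
    using assms(2) by (intro prod_nonneg) auto
  have "(\<Prod>i\<in>S. x i ^ w i) powr (1 / d) \<le> (\<Sum>i\<in>S. real (w i) * x i) / d"
    using arith_geom_mean[of T "\<lambda>p. x (fst p)"] T \<open>T \<noteq> {}\<close> assms(2)
    unfolding prod sum by (auto simp: T_def)
  then have "((\<Prod>i\<in>S. x i ^ w i) powr (1 / d)) ^ d \<le> ((\<Sum>i\<in>S. real (w i) * x i) / d) ^ d"
    by (intro power_mono) auto
  \<comment> \<open>The exponents cancel for a positive product; if the product is 0, both sides are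
    0 because \<open>d\<close> is positive.\<close>
  moreover have "((\<Prod>i\<in>S. x i ^ w i) powr (1 / d)) ^ d = (\<Prod>i\<in>S. x i ^ w i)"
    using nonneg assms(3) unfolding d_def[symmetric]
    by (cases "(\<Prod>i\<in>S. x i ^ w i) = 0") (simp_all add: powr_power)
  ultimately show ?thesis
    by (simp add: d_def)
qed

lemma monomial_gap_has_max_on:
  fixes \<alpha> :: "nat ^ 'n" and d :: nat
  assumes d: "d = (\<Sum>j\<in>UNIV. \<alpha> $ j)" and "0 < d"
  shows "has_max_on
           (\<lambda>x :: real ^ 'n. (\<Prod>j\<in>UNIV. (x $ j) ^ (\<alpha> $ j))
              - max 0 (1 + (\<Sum>j\<in>UNIV. real (\<alpha> $ j) * (x $ j - 1))))
           (cbox 0 1) ((1 - 1 / real d) ^ d)"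
  unfolding has_max_on_def
proof (intro conjI ballI bexI)
  \<comment> \<open>\<open>c\<close> is the root of \<open>1 + d * (s - 1)\<close>, the affine term
    written in the weighted mean \<open>s\<close>. On the diagonal at \<open>c\<close> only the
    power \<open>c ^ d\<close> is left.\<close>
  define c where "c = 1 - 1 / real d"
  have c: "0 \<le> c" "c \<le> 1" "d * (1 - c) = 1"
    using \<open>0 < d\<close> by (auto simp: c_def)
  show "(\<chi> j. c) \<in> cbox (0 :: real ^ 'n) 1"
    using c by (simp add: mem_box_cart)
  have "(\<Sum>j\<in>UNIV. real (\<alpha> $ j) * (c - 1)) = d * (c - 1)"
    by (simp add: d flip: sum_distrib_right)
  also have "\<dots> = - 1"
    using c(3) by (simp add: algebra_simps)
  finally show "(\<Prod>j\<in>UNIV. (\<chi> j :: 'n. c) $ j ^ \<alpha> $ j)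
      - max 0 (1 + (\<Sum>j\<in>UNIV. real (\<alpha> $ j) * ((\<chi> j. c) $ j - 1))) = (1 - 1 / real d) ^ d"
    by (simp add: d c_def flip: power_sum)
  fix x :: "real ^ 'n"
  assume "x \<in> cbox 0 1"
  then have x: "0 \<le> x $ j" "x $ j \<le> 1" for j
    by (auto simp: mem_box_cart)
  define s where "s = (\<Sum>j\<in>UNIV. real (\<alpha> $ j) * x $ j) / d"
  have "(\<Sum>j\<in>UNIV. real (\<alpha> $ j) * x $ j) \<le> (\<Sum>j\<in>UNIV. real (\<alpha> $ j) * 1)"
    using x by (intro sum_mono mult_left_mono) auto
  also have "\<dots> = d"
    by (simp add: d)
  finally have s: "0 \<le> s" "s \<le> 1"
    using x \<open>0 < d\<close> by (simp_all add: s_def sum_nonneg divide_le_eq)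
  have "(\<Prod>j\<in>UNIV. x $ j ^ \<alpha> $ j) \<le> s ^ d"
    using weighted_arith_geom_mean[of UNIV "($) x" "($) \<alpha>"] x \<open>0 < d\<close> by (simp add: s_def d)
  moreover have "1 + (\<Sum>j\<in>UNIV. real (\<alpha> $ j) * (x $ j - 1)) = d * (s - c)"
  proof -
    have "(\<Sum>j\<in>UNIV. real (\<alpha> $ j) * (x $ j - 1))
        = (\<Sum>j\<in>UNIV. real (\<alpha> $ j) * x $ j) - d"
      by (simp add: right_diff_distrib sum_subtractf d)
    also have "\<dots> = d * s - d"
      using \<open>0 < d\<close> by (simp add: s_def)
    finally show ?thesis
      using c(3) by (simp add: algebra_simps)
  qed
  \<comment> \<open>Up to \<open>c\<close> only the increasing power counts; beyond \<open>c\<close>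
    it grows by at most \<open>d * (s - c)\<close>, which the affine term subtracts.\<close>
  moreover have "s ^ d - max 0 (d * (s - c)) \<le> c ^ d"
  proof (cases "s \<le> c")
    case True
    then show ?thesis
      using power_mono[OF True s(1), of d] by linarith
  next
    case False
    then show ?thesis
      using power_diff_le_of_unit_interval[of c s d] c s by linarith
  qed
  ultimately show "(\<Prod>j\<in>UNIV. x $ j ^ \<alpha> $ j)
      - max 0 (1 + (\<Sum>j\<in>UNIV. real (\<alpha> $ j) * (x $ j - 1))) \<le> (1 - 1 / real d) ^ d"
    unfolding c_def by linarith
qed

text \<open>The witness \<open>g\<close> makes the set under the supremum nonempty; for the empty
  set, \<open>Sup\<close> on the reals would say nothing.\<close>

lemma convex_envelope_le:
  assumes "convex_on S g" "\<forall>y\<in>S. g y \<le> f y"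
    and "\<And>h. convex_on S h \<Longrightarrow> \<forall>y\<in>S. h y \<le> f y \<Longrightarrow> h x \<le> b"
  shows "convex_envelope S f x \<le> b"
  unfolding convex_envelope_def using assms by (intro cSup_least) auto

text \<open>For \<open>x\<close> in \<open>S\<close> the values of all underestimators at
  \<open>x\<close> are bounded above by \<open>f x\<close>, so the supremum is a genuine upper
  bound.\<close>

lemma le_convex_envelope:
  assumes "x \<in> S" and "convex_on S g" "\<forall>y\<in>S. g y \<le> f y"
  shows "g x \<le> convex_envelope S f x"
  unfolding convex_envelope_def using assms
  by (intro cSup_upper bdd_aboveI[of _ "f x"]) auto

lemma convex_on_max:
  assumes "convex_on S f" "convex_on S g"
  shows "convex_on S (\<lambda>x. max (f x) (g x))"
  unfolding convex_on_def
proof (intro conjI ballI allI impI)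
  show "convex S"
    using assms(1) by (rule convex_on_imp_convex)
  fix x y and u v :: real
  assume *: "x \<in> S" "y \<in> S" "0 \<le> u" "0 \<le> v" "u + v = 1"
  have "f (u *\<^sub>R x + v *\<^sub>R y) \<le> u * f x + v * f y" "g (u *\<^sub>R x + v *\<^sub>R y) \<le> u * g x + v * g y"
    using assms * by (auto simp: convex_on_def)
  moreover have "u * f x \<le> u * max (f x) (g x)" "v * f y \<le> v * max (f y) (g y)"
    "u * g x \<le> u * max (f x) (g x)" "v * g y \<le> v * max (f y) (g y)"
    using * by (auto intro!: mult_left_mono)
  ultimately show "max (f (u *\<^sub>R x + v *\<^sub>R y)) (g (u *\<^sub>R x + v *\<^sub>R y))
      \<le> u * max (f x) (g x) + v * max (f y) (g y)"
    by linarith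
qed

lemma convex_on_max_affine:
  "convex_on (cbox 0 1) (\<lambda>x :: real ^ 'n. max 0 (1 + (\<Sum>j\<in>UNIV. (x $ j - 1))))"
proof (rule convex_on_max)
  show "convex_on (cbox 0 1) (\<lambda>x :: real ^ 'n. 0)"
    by (simp add: convex_on_const)
  \<comment> \<open>An affine function attains equality in the convexity inequality;
    \<open>u + v = 1\<close> makes the constant terms agree.\<close>
  have "1 + (\<Sum>j\<in>UNIV. (u *\<^sub>R x + v *\<^sub>R y) $ j - 1)
      = u * (1 + (\<Sum>j\<in>UNIV. (x $ j - 1))) + v * (1 + (\<Sum>j\<in>UNIV. (y $ j - 1)))"
    if "u + v = 1" for x y :: "real ^ 'n" and u v :: real
  proof -
    have u: "u = 1 - v"
      using that by simp
    show ?thesis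
      unfolding u
      by (simp add: sum_subtractf sum.distrib algebra_simps flip: sum_distrib_left)
  qed
  then show "convex_on (cbox 0 1) (\<lambda>x :: real ^ 'n. 1 + (\<Sum>j\<in>UNIV. (x $ j - 1)))"
    by (simp add: convex_on_def)
qed

lemma max_affine_le_prod:
  fixes x :: "real ^ 'n"
  assumes "x \<in> cbox 0 1"
  shows "max 0 (1 + (\<Sum>j\<in>UNIV. (x $ j - 1))) \<le> (\<Prod>j\<in>UNIV. x $ j)"
proof -
  have x: "0 \<le> x $ j" "x $ j \<le> 1" for j
    using assms by (auto simp: mem_box_cart)
  \<comment> \<open>The Weierstrass product inequality is applied to the complements
    \<open>1 - x $ j\<close>, which also lie in the unit interval.\<close>
  have "1 - (\<Sum>j\<in>UNIV. 1 - x $ j) \<le> (\<Prod>j\<in>UNIV. 1 - (1 - x $ j))"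
    using x by (intro Weierstrass_prod_ineq) auto
  moreover have "0 \<le> (\<Prod>j\<in>UNIV. x $ j)"
    using x by (intro prod_nonneg) auto
  ultimately show ?thesis
    by (simp add: sum_subtractf)
qed

text \<open>The point \<open>(1 - 1/n, \<dots>, 1 - 1/n)\<close> is the barycentre of the \<open>n\<close> vertices \<open>1 - e\<^sub>j\<close>,
  where the monomial vanishes.\<close>

lemma convex_minorant_prod_nonpos:
  fixes g :: "real ^ 'n \<Rightarrow> real"
  assumes "convex_on (cbox 0 1) g" and "\<forall>y\<in>cbox 0 1. g y \<le> (\<Prod>j\<in>UNIV. y $ j)"
  shows "g (\<chi> j. 1 - 1 / CARD('n)) \<le> 0"
proof -
  define p :: "'n \<Rightarrow> real ^ 'n" where "p i = 1 - axis i 1" for i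
  have p: "p i \<in> cbox 0 1" for i
    by (simp add: p_def mem_box_cart axis_def)
  have "(\<Prod>j\<in>UNIV. p i $ j) = 0" for i
    by (simp add: p_def axis_def)
  then have gp: "g (p i) \<le> 0" for i
    using assms(2) p by metis
  have "(\<chi> j. 1 - 1 / CARD('n)) = (\<Sum>i\<in>UNIV. (1 / CARD('n)) *\<^sub>R p i)"
    by (simp add: vec_eq_iff p_def axis_def sum_subtractf diff_divide_distrib flip: sum_divide_distrib)
  also have "g \<dots> \<le> (\<Sum>i\<in>UNIV. 1 / CARD('n) * g (p i))"
    using assms(1) p by (intro convex_on_sum) auto
  also have "\<dots> \<le> 0"
    using gp by (intro sum_nonpos mult_nonneg_nonpos) auto
  finally show ?thesis .
qed

lemma convex_envelope_prod_error:
  "has_max_on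
     (\<lambda>x :: real ^ 'n. \<bar>convex_envelope (cbox 0 1) (\<lambda>y. \<Prod>j\<in>UNIV. y $ j) x - (\<Prod>j\<in>UNIV. x $ j)\<bar>)
     (cbox 0 1) ((1 - 1 / real CARD('n)) ^ CARD('n))"
  unfolding has_max_on_def
proof (intro conjI ballI bexI)
  let ?m = "\<lambda>x :: real ^ 'n. \<Prod>j\<in>UNIV. x $ j"
  let ?l = "\<lambda>x :: real ^ 'n. max 0 (1 + (\<Sum>j\<in>UNIV. (x $ j - 1)))"
  let ?c = "\<chi> j :: 'n. 1 - 1 / real CARD('n)"
  have l: "convex_on (cbox 0 1) ?l" "\<forall>y\<in>cbox 0 1. ?l y \<le> ?m y"
    using convex_on_max_affine max_affine_le_prod by auto
  show c: "?c \<in> cbox 0 1"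
    by (simp add: mem_box_cart)
  \<comment> \<open>At \<open>?c\<close> the envelope is squeezed between \<open>?l\<close>, which
    is nonnegative, and 0, so the error there is the value of the monomial.\<close>
  have "convex_envelope (cbox 0 1) ?m ?c \<le> 0"
    using l by (rule convex_envelope_le) (rule convex_minorant_prod_nonpos)
  moreover have "0 \<le> convex_envelope (cbox 0 1) ?m ?c"
    using le_convex_envelope[OF c l] by linarith
  ultimately have "convex_envelope (cbox 0 1) ?m ?c = 0"
    by (rule antisym)
  then show "\<bar>convex_envelope (cbox 0 1) ?m ?c - ?m ?c\<bar> = (1 - 1 / real CARD('n)) ^ CARD('n)"
    by simp
  fix x :: "real ^ 'n"
  assume x: "x \<in> cbox 0 1"
  have "convex_envelope (cbox 0 1) ?m x \<le> ?m x"
    using l by (rule convex_envelope_le) (use x in auto)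
  moreover have "?l x \<le> convex_envelope (cbox 0 1) ?m x"
    using le_convex_envelope[OF x l] .
  \<comment> \<open>With all exponents equal to 1 the degree is the dimension, and the first gap
    bound applies.\<close>
  moreover have "?m x - ?l x \<le> (1 - 1 / real CARD('n)) ^ CARD('n)"
    using monomial_gap_has_max_on[of "CARD('n)" "1 :: nat ^ 'n"] x
    by (simp add: has_max_on_def)
  ultimately show "\<bar>convex_envelope (cbox 0 1) ?m x - ?m x\<bar> \<le> (1 - 1 / real CARD('n)) ^ CARD('n)"
    by linarith
qed

theorem corollary3p4:
  fixes \<alpha> :: "nat ^ 'n" and d :: nat
  assumes "CARD('n) \<ge> 2"
    and "\<And>j. \<alpha> $ j \<ge> 1"
    and "d = (\<Sum>j\<in>UNIV. \<alpha> $ j)"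
  shows "has_max_on
           (\<lambda>x :: real ^ 'n. (\<Prod>j\<in>UNIV. (x $ j) ^ (\<alpha> $ j))
              - max 0 (1 + (\<Sum>j\<in>UNIV. real (\<alpha> $ j) * (x $ j - 1))))
           (cbox 0 1) ((1 - 1 / real d) ^ d)
       \<and> has_max_on
           (\<lambda>x :: real ^ 'n. \<bar>convex_envelope (cbox 0 1) (\<lambda>y. \<Prod>j\<in>UNIV. y $ j) x
              - (\<Prod>j\<in>UNIV. x $ j)\<bar>)
           (cbox 0 1) ((1 - 1 / real CARD('n)) ^ CARD('n))"
proof
  have "0 < d"
    unfolding assms(3) using assms(2) by (intro sum_pos) (auto simp: Suc_le_eq)
  with assms(3) show "has_max_on
           (\<lambda>x :: real ^ 'n. (\<Prod>j\<in>UNIV. (x $ j) ^ (\<alpha> $ j))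
              - max 0 (1 + (\<Sum>j\<in>UNIV. real (\<alpha> $ j) * (x $ j - 1))))
           (cbox 0 1) ((1 - 1 / real d) ^ d)"
    by (rule monomial_gap_has_max_on)
qed (rule convex_envelope_prod_error)

end
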